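(* Let $\mathcal H=\mathcal H_0\oplus\mathcal H_1$, $A$, $W$, $V$, $X$, $Y$, $T$ be as in the context. The following are equivalent: (i) The graph subspace $\mathcal G(\mathcal H_0,X)$ is reducing for the operator $A+V$, that is, $\mathcal G(\mathcal H_0,X)$ and $\mathcal G(\mathcal H_1,-X^* )$ are invariant for $A+V$ and $\mathrm{Dom}(A+V)=\mathrm{Dom}(A)$ splits as $\mathrm{Dom}(A)=\bigl(\mathrm{Dom}(A)\cap\mathcal G(\mathcal H_0,X)\bigr)+\bigl(\mathrm{Dom}(A)\cap\mathcal G(\mathcal H_1,-X^* )\bigr)$. (ii) The graph subspaces $\mathcal G(\mathcal H_0,X)$ and $\mathcal G(\mathcal H_1,-X^* )$ are invariant for $A+V$, and $T^{-1}$ (respectively, $(T^* )^{-1}$) maps $\mathrm{Dom}(A)$ into itself. (iii) One has the operator extension relation $T^*(A+V)\supset(A-YV)T^*$. (In (ii), either version, with $T^{-1}$ or with $(T^* )^{-1}$, may be used.)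
   Context: Hilbert spaces are complex. Setting: $\mathcal H=\mathcal H_0\oplus\mathcal H_1$ is a Hilbert space decomposed into two orthogonal subspaces. $A=\begin{pmatrix}A_0&0\\0&A_1\end{pmatrix}$ with $\mathrm{Dom}(A)=\mathrm{Dom}(A_0)\oplus\mathrm{Dom}(A_1)$ is a (possibly unbounded) self-adjoint operator on $\mathcal H$. $W\colon\mathcal H_1\supset\mathrm{Dom}(W)\to\mathcal H_0$ is a densely defined linear operator with $\mathrm{Dom}(W)\supset\mathrm{Dom}(A_1)$ and $\mathrm{Dom}(W^* )\supset\mathrm{Dom}(A_0)$, and $V=\begin{pmatrix}0&W\\ W^*&0\end{pmatrix}$ on $\mathrm{Dom}(V)=\mathrm{Dom}(W^* )\oplus\mathrm{Dom}(W)\supset\mathrm{Dom}(A)$. $X\colon\mathcal H_0\to\mathcal H_1$ is a bounded linear operator, and $$Y=\begin{pmatrix}0&-X^*\\ X&0\end{pmatrix},\qquad T=I_{\mathcal H}+Y=\begin{pmatrix}I_{\mathcal H_0}&-X^*\\ X&I_{\mathcal H_1}\end{pmatrix}$$ are bounded operators on $\mathcal H$. Since $Y^*=-Y$, one has $T^*=I_{\mathcal H}-Y$, and $T$, $T^*$ are boundedly invertible. Conventions on unbounded operators: sums and products have their natural domains, $\mathrm{Dom}(K+L)=\mathrm{Dom}(K)\cap\mathrm{Dom}(L)$ and $\mathrm{Dom}(KL)=\{x\in\mathrm{Dom}(L):Lx\in\mathrm{Dom}(K)\}$. In particular $\mathrm{Dom}(A+V)=\mathrm{Dom}(A)=\mathrm{Dom}(A-YV)$.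 $L\supset K$ (or $K\subset L$) means $\mathrm{Dom}(K)\subset\mathrm{Dom}(L)$ and $Kx=Lx$ on $\mathrm{Dom}(K)$. Graph subspaces: $\mathcal G(\mathcal H_0,X)=\{f\oplus Xf:f\in\mathcal H_0\}$, a closed subspace with orthogonal complement $\mathcal G(\mathcal H_1,-X^* )=\{-X^*g\oplus g:g\in\mathcal H_1\}$. A closed subspace $\mathcal G\subset\mathcal H$ is invariant for a linear operator $B$ if $Bx\in\mathcal G$ for all $x\in\mathrm{Dom}(B)\cap\mathcal G$. *)

theory Defs
  imports "HOL-Analysis.Analysis"
begin

section \<open>Complex Hilbert spaces\<close>

text \<open>
  A complex inner product space is a real inner product space (with real inner product
  the real part of the complex one) carrying a compatible complex structure; norm and topology
  are those of the class \<^class>\<open>real_inner\<close>. The inner product is linear in its first argument.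
\<close>

class complex_inner = real_inner +
  fixes scaleC :: "complex \<Rightarrow> 'a \<Rightarrow> 'a"  (infixr "*c" 75)
    and cinner :: "'a \<Rightarrow> 'a \<Rightarrow> complex"
  assumes scaleC_add_right: "a *c (x + y) = a *c x + a *c y"
    and scaleC_add_left: "(a + b) *c x = a *c x + b *c x"
    and scaleC_scaleC: "a *c (b *c x) = (a * b) *c x"
    and scaleC_of_real: "complex_of_real r *c x = r *\<^sub>R x"
    and cinner_commute: "cinner x y = cnj (cinner y x)"
    and cinner_add_left: "cinner (x + y) z = cinner x z + cinner y z"
    and cinner_scaleC_left: "cinner (a *c x) y = a * cinner x y"
    and Re_cinner: "Re (cinner x y) = inner x y"

class complex_hilbert = complex_inner + complete_space

text \<open>The orthogonal direct sum of two Hilbert spaces is their product type.\<close>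

instantiation prod :: (complex_inner, complex_inner) complex_inner
begin

definition scaleC_prod_def: "a *c p = (a *c fst p, a *c snd p)"

definition cinner_prod_def: "cinner p q = cinner (fst p) (fst q) + cinner (snd p) (snd q)"

instance
proof
  fix a b :: complex and r :: real and x y z :: "'a \<times> 'b"
  show "a *c (x + y) = a *c x + a *c y"
    by (simp add: scaleC_prod_def scaleC_add_right)
  show "(a + b) *c x = a *c x + b *c x"
    by (simp add: scaleC_prod_def scaleC_add_left)
  show "a *c (b *c x) = (a * b) *c x"
    by (simp add: scaleC_prod_def scaleC_scaleC)
  show "complex_of_real r *c x = r *\<^sub>R x"
    by (simp add: scaleC_prod_def scaleC_of_real scaleR_prod_def)
  show "cinner x y = cnj (cinner y x)"
    unfolding cinner_prod_def complex_cnj_add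
    by (simp only: cinner_commute [symmetric])
  show "cinner (x + y) z = cinner x z + cinner y z"
    by (simp add: cinner_prod_def cinner_add_left)
  show "cinner (a *c x) y = a * cinner x y"
    by (simp add: cinner_prod_def scaleC_prod_def cinner_scaleC_left distrib_left)
  show "Re (cinner x y) = inner x y"
    by (simp add: cinner_prod_def Re_cinner inner_prod_def)
qed

end

instance prod :: (complex_hilbert, complex_hilbert) complex_hilbert ..


section \<open>Unbounded operators\<close>

text \<open>
  A (possibly unbounded) operator is a partial function \<^typ>\<open>'a \<rightharpoonup> 'b\<close>, with domain
  \<^term>\<open>dom K\<close>. The extension relation $K \subset L$ is the library's \<^term>\<open>K \<subseteq>\<^sub>m L\<close>
  and the product $KL$ with its natural domain is \<^term>\<open>K \<circ>\<^sub>m L\<close>. An everywhere defined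
  operator \<open>f\<close> is an ordinary function, viewed as an operator by \<open>total_op f\<close>.
\<close>

abbreviation total_op :: "('a \<Rightarrow> 'b) \<Rightarrow> ('a \<rightharpoonup> 'b)" where
  "total_op f \<equiv> (\<lambda>x. Some (f x))"

definition linear_op :: "('a::complex_inner \<rightharpoonup> 'b::complex_inner) \<Rightarrow> bool" where
  "linear_op K \<longleftrightarrow>
     0 \<in> dom K \<and>
     (\<forall>x\<in>dom K. \<forall>y\<in>dom K. x + y \<in> dom K \<and> the (K (x + y)) = the (K x) + the (K y)) \<and>
     (\<forall>c. \<forall>x\<in>dom K. c *c x \<in> dom K \<and> the (K (c *c x)) = c *c the (K x))"

definition densely_defined :: "('a::complex_inner \<rightharpoonup> 'b::complex_inner) \<Rightarrow> bool" where
  "densely_defined K \<longleftrightarrow> closure (dom K) = UNIV"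

definition op_add :: "('a \<rightharpoonup> 'b::complex_inner) \<Rightarrow> ('a \<rightharpoonup> 'b) \<Rightarrow> ('a \<rightharpoonup> 'b)"  (infixl "+\<^sub>o" 65) where
  "K +\<^sub>o L = (\<lambda>x. if x \<in> dom K \<inter> dom L then Some (the (K x) + the (L x)) else None)"

definition op_diff :: "('a \<rightharpoonup> 'b::complex_inner) \<Rightarrow> ('a \<rightharpoonup> 'b) \<Rightarrow> ('a \<rightharpoonup> 'b)"  (infixl "-\<^sub>o" 65) where
  "K -\<^sub>o L = (\<lambda>x. if x \<in> dom K \<inter> dom L then Some (the (K x) - the (L x)) else None)"

text \<open>The vector \<open>z\<close> below is unique, and so the adjoint meaningful, if \<open>K\<close> is densely defined.\<close>

definition op_adjoint :: "('a::complex_inner \<rightharpoonup> 'b::complex_inner) \<Rightarrow> ('b \<rightharpoonup> 'a)" where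
  "op_adjoint K = (\<lambda>y.
     if \<exists>z. \<forall>x\<in>dom K. cinner (the (K x)) y = cinner x z
     then Some (THE z. \<forall>x\<in>dom K. cinner (the (K x)) y = cinner x z)
     else None)"

definition self_adjoint_op :: "('a::complex_inner \<rightharpoonup> 'a) \<Rightarrow> bool" where
  "self_adjoint_op K \<longleftrightarrow> linear_op K \<and> densely_defined K \<and> op_adjoint K = K"

definition invariant_for :: "'a set \<Rightarrow> ('a \<rightharpoonup> 'a) \<Rightarrow> bool" where
  "invariant_for G B \<longleftrightarrow> (\<forall>x \<in> dom B \<inter> G. the (B x) \<in> G)"

text \<open>
  Here \<open>G\<close> is a closed subspace and \<open>G'\<close> its orthogonal complement: \<open>G\<close> is reducing for \<open>B\<close>
  if both are invariant and the domain of \<open>B\<close> splits along them.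
\<close>

definition reducing_for :: "'a::complex_inner set \<Rightarrow> 'a set \<Rightarrow> ('a \<rightharpoonup> 'a) \<Rightarrow> bool" where
  "reducing_for G G' B \<longleftrightarrow>
     invariant_for G B \<and> invariant_for G' B \<and>
     dom B = {u + v | u v. u \<in> dom B \<inter> G \<and> v \<in> dom B \<inter> G'}"


section \<open>Bounded operators\<close>

definition bounded_clinear :: "('a::complex_inner \<Rightarrow> 'b::complex_inner) \<Rightarrow> bool" where
  "bounded_clinear X \<longleftrightarrow> bounded_linear X \<and> (\<forall>c x. X (c *c x) = c *c X x)"

text \<open>The adjoint of a bounded operator on a Hilbert space is everywhere defined.\<close>

definition badjoint :: "('a::complex_inner \<Rightarrow> 'b::complex_inner) \<Rightarrow> 'b \<Rightarrow> 'a" where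
  "badjoint X = (\<lambda>y. the (op_adjoint (total_op X) y))"


section \<open>Block operator matrices and graph subspaces\<close>

text \<open>
  \<open>block_diag A0 A1\<close> has the diagonal entries \<open>A0\<close>, \<open>A1\<close>; \<open>block_offdiag B C\<close> has the upper
  right entry \<open>B\<close> and the lower left entry \<open>C\<close>. The entry \<open>0\<close> is everywhere defined.
\<close>

definition block_diag :: "('a \<rightharpoonup> 'a) \<Rightarrow> ('b \<rightharpoonup> 'b) \<Rightarrow> ('a \<times> 'b \<rightharpoonup> 'a \<times> 'b)" where
  "block_diag A0 A1 = (\<lambda>(f, g).
     if f \<in> dom A0 \<and> g \<in> dom A1 then Some (the (A0 f), the (A1 g)) else None)"

definition block_offdiag :: "('b \<rightharpoonup> 'a) \<Rightarrow> ('a \<rightharpoonup> 'b) \<Rightarrow> ('a \<times> 'b \<rightharpoonup> 'a \<times> 'b)" where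
  "block_offdiag B C = (\<lambda>(f, g).
     if f \<in> dom C \<and> g \<in> dom B then Some (the (B g), the (C f)) else None)"

definition skew_block :: "('a::complex_inner \<Rightarrow> 'b::complex_inner) \<Rightarrow> 'a \<times> 'b \<Rightarrow> 'a \<times> 'b" where
  "skew_block X = (\<lambda>(f, g). (- badjoint X g, X f))"

text \<open>
  \<open>graph0 X\<close> is $\mathcal G(\mathcal H_0, X)$ for \<open>X\<close> from the first to the second summand;
  \<open>graph1 Z\<close> is $\mathcal G(\mathcal H_1, Z)$ for \<open>Z\<close> from the second to the first summand.
\<close>

definition graph0 :: "('a \<Rightarrow> 'b) \<Rightarrow> ('a \<times> 'b) set" where
  "graph0 X = {(f, X f) | f. True}"

definition graph1 :: "('b \<Rightarrow> 'a) \<Rightarrow> ('a \<times> 'b) set" where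
  "graph1 Z = {(Z g, g) | g. True}"

end

theory Submission
  imports Defs
begin

text \<open>
  Write $D = D_0 \times D_1$ for the domain of $A$. The operator $T$ maps the two summands onto
  the two graph subspaces, so the splitting of $D$ and the inclusion $T^{-1} D \subseteq D$ both say
  that $f \in D_0$ and $g \in D_1$ whenever $(f - X^* g, X f + g) \in D$; the substitution
  $g \mapsto -g$ gives the version for $T^*$. For $x \in D$ with $Y x \in D$, the invariance of the two graphs is
  componentwise the Riccati equation $A Y x - Y A x - Y V Y x + V x = 0$, which is what the
  extension relation says.
\<close>

section \<open>Bounded operators on Hilbert spaces\<close>

text \<open>
  The representing vector minimizes $|x|^2 - 2 f(x)$; minimizing sequences are Cauchy by the
  parallelogram law.
\<close>

lemma riesz_representation:
  fixes f :: "'a::{real_inner, complete_space} \<Rightarrow> real"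
  assumes "bounded_linear f"
  shows "\<exists>z. \<forall>x. f x = inner x z"
proof -
  interpret f: bounded_linear f by fact
  obtain K where K: "\<And>x. \<bar>f x\<bar> \<le> norm x * K"
    using f.bounded by (auto simp: real_norm_def)
  define q where "q x = inner x x - 2 * f x" for x
  define m where "m = Inf (range q)"
  \<comment> \<open>Completing the square in \<open>norm x\<close>: the bound on \<open>f\<close>
    gives \<open>q x\<close> at least \<open>(norm x - K)^2 - K^2\<close>.\<close>
  have "- (K\<^sup>2) \<le> q x" for x
  proof -
    have "0 \<le> (norm x - K)\<^sup>2" by simp
    also have "\<dots> = inner x x - 2 * (norm x * K) + K\<^sup>2"
      by (simp add: power2_diff power2_norm_eq_inner)
    also have "\<dots> \<le> q x + K\<^sup>2" using K[of x] by (simp add: q_def)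
    finally show ?thesis by simp
  qed
  then have bdd: "bdd_below (range q)" by (intro bdd_belowI2)
  have m_le: "m \<le> q x" for x
    unfolding m_def by (intro cInf_lower bdd) simp
  have "\<exists>x. q x < m + 1 / real (Suc n)" for n
    using cInf_lessD[of "range q" "m + 1 / real (Suc n)"] by (auto simp: m_def)
  then obtain s where s: "\<And>n. q (s n) < m + 1 / real (Suc n)" by metis
  \<comment> \<open>In the parallelogram identity for \<open>x\<close>, \<open>y\<close> and their
    midpoint the contributions of \<open>f\<close> cancel, and \<open>q\<close> at the midpoint is
    at least \<open>m\<close>.\<close>
  have dist_le: "(dist x y)\<^sup>2 \<le> 2 * (q x - m) + 2 * (q y - m)" for x y
  proof -
    have "(dist x y)\<^sup>2 = 2 * q x + 2 * q y - 4 * q ((1/2) *\<^sub>R (x + y))"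
      by (simp add: q_def dist_norm power2_norm_eq_inner f.scaleR f.add inner_diff inner_add
          inner_commute algebra_simps)
    with m_le[of "(1/2) *\<^sub>R (x + y)"] show ?thesis by simp
  qed
  have "Cauchy s"
  proof (rule metric_CauchyI)
    fix e :: real assume "0 < e"
    \<comment> \<open>The estimate \<open>dist_le\<close> doubles each of two excesses over
      \<open>m\<close>, so a quarter of \<open>e\<^sup>2\<close> per point suffices.\<close>
    then obtain N where N: "1 / real (Suc N) < e\<^sup>2 / 4"
      using nat_approx_posE[of "e\<^sup>2 / 4"] by auto
    have small: "q (s n) - m < e\<^sup>2 / 4" if "n \<ge> N" for n
    proof -
      have "1 / real (Suc n) \<le> 1 / real (Suc N)" using that by (intro divide_left_mono) auto
      with s[of n] N show ?thesis by linarith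
    qed
    have "dist (s i) (s j) < e" if "i \<ge> N" "j \<ge> N" for i j
    proof (rule power2_less_imp_less)
      show "(dist (s i) (s j))\<^sup>2 < e\<^sup>2"
        using dist_le[of "s i" "s j"] small[OF that(1)] small[OF that(2)] by argo
    qed (use \<open>0 < e\<close> in simp)
    then show "\<exists>M. \<forall>i\<ge>M. \<forall>j\<ge>M. dist (s i) (s j) < e" by blast
  qed
  then obtain z where z: "s \<longlonglongrightarrow> z"
    using Cauchy_convergent convergent_def by blast
  have "(\<lambda>n. q (s n)) \<longlonglongrightarrow> q z"
    unfolding q_def by (intro tendsto_intros f.tendsto z)
  moreover have "(\<lambda>n. m + 1 / real (Suc n)) \<longlonglongrightarrow> m + 0"
    by (intro tendsto_intros LIMSEQ_Suc lim_1_over_n)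
  ultimately have "q z \<le> m + 0"
    by (rule LIMSEQ_le) (use s less_imp_le in blast)
  then have min: "q z \<le> q x" for x using m_le[of x] by simp
  have "f x = inner x z" for x
  proof (cases "x = 0")
    case False
    \<comment> \<open>\<open>2 * d\<close> is the derivative of \<open>q\<close> at \<open>z\<close>
      in direction \<open>x\<close>, and \<open>t\<close> minimizes the resulting quadratic
      polynomial along that line. As its minimum cannot drop below \<open>q z\<close>,
      \<open>d\<close> vanishes.\<close>
    define d where "d = inner x z - f x"
    define t where "t = - d / inner x x"
    have "q (z + t *\<^sub>R x) = q z + 2 * t * d + t * t * inner x x"
      by (simp add: q_def d_def f.scaleR f.add inner_add inner_commute algebra_simps)
    also have "\<dots> = q z - d\<^sup>2 / inner x x"
      using False by (simp add: t_def power2_eq_square)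
    finally have "d\<^sup>2 / inner x x \<le> 0" using min[of "z + t *\<^sub>R x"] by simp
    moreover have "0 < inner x x" using False by simp
    ultimately have "d\<^sup>2 \<le> 0" by (simp add: divide_le_0_iff)
    then show ?thesis by (simp add: d_def)
  qed (simp add: f.zero)
  then show ?thesis by blast
qed

text \<open>
  For small $\varepsilon$ the map $x \mapsto x - \varepsilon (x + Y x - h)$ is a contraction,
  because $x$ and $Y x$ are orthogonal.
\<close>

lemma bij_id_plus_skew:
  fixes Y :: "'a::{real_inner, complete_space} \<Rightarrow> 'a"
  assumes "bounded_linear Y" and skew: "\<And>x. inner x (Y x) = 0"
  shows "bij (\<lambda>x. x + Y x)"
proof -
  interpret Y: bounded_linear Y by fact
  obtain K where K: "\<And>x. norm (Y x) \<le> norm x * K" using Y.bounded by auto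
  \<comment> \<open>By orthogonality the squared contraction factor is at most
    \<open>(1 - e)^2 + e^2 * K^2 = 1 - 2 * e + e^2 * (1 + K^2)\<close>; this choice of
    \<open>e\<close> turns it into \<open>1 - e\<close>.\<close>
  define e where "e = 1 / (1 + K\<^sup>2)"
  have pos: "0 < 1 + K\<^sup>2" by (simp add: add_pos_nonneg)
  then have e: "0 < e" "e \<le> 1" "e * (1 + K\<^sup>2) = 1" by (auto simp: e_def)
  have "\<exists>!x. x - e *\<^sub>R (x + Y x - h) = x" for h
  proof -
    define F where "F x = x - e *\<^sub>R (x + Y x - h)" for x
    have "dist (F x) (F y) \<le> sqrt (1 - e) * dist x y" for x y
    proof -
      define d where "d = x - y"
      have "F x - F y = (1 - e) *\<^sub>R d - e *\<^sub>R Y d"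
        by (simp add: F_def d_def Y.diff algebra_simps)
      then have "(dist (F x) (F y))\<^sup>2 = (1 - e)\<^sup>2 * (norm d)\<^sup>2 + e\<^sup>2 * (norm (Y d))\<^sup>2"
        using skew[of d]
        unfolding dist_norm power2_norm_eq_inner
        by (simp add: inner_diff inner_commute power2_eq_square)
      also have "\<dots> \<le> (1 - e)\<^sup>2 * (norm d)\<^sup>2 + e\<^sup>2 * (norm d * K)\<^sup>2"
        by (intro add_mono mult_left_mono power_mono K) auto
      also have "\<dots> = (1 - 2 * e + e * (e * (1 + K\<^sup>2))) * (norm d)\<^sup>2"
        by (simp add: power2_eq_square algebra_simps)
      also have "\<dots> = (sqrt (1 - e) * dist x y)\<^sup>2"
        using e by (simp add: power_mult_distrib d_def dist_norm)
      finally show ?thesis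
        by (rule power2_le_imp_le) (use e in simp)
    qed
    then have "\<exists>!x. x \<in> UNIV \<and> F x = x"
      by (intro Banach_fix[where c = "sqrt (1 - e)"]) (use e in \<open>auto simp: complete_UNIV\<close>)
    then show ?thesis by (simp add: F_def)
  qed
  then have "\<exists>!x. x + Y x = h" for h using e by simp
  then show ?thesis by (simp add: bij_iff)
qed

section \<open>Adjoints\<close>

lemma cinner_add_right: "cinner x (y + z) = cinner x y + cinner x z"
  by (metis cinner_add_left cinner_commute complex_cnj_add)

lemma cinner_scaleC_right: "cinner x (a *c y) = cnj a * cinner x y"
  by (metis cinner_commute cinner_scaleC_left complex_cnj_mult)

lemma scaleC_minus_one: "(- 1) *c x = - x"
  using scaleC_of_real[of "- 1" x] by simp

lemma cinner_minus_right: "cinner x (- y) = - cinner x y"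
  using cinner_scaleC_right[of x "- 1" y] by (simp add: scaleC_minus_one)

lemma cinner_minus_left: "cinner (- x) y = - cinner x y"
  by (metis cinner_commute cinner_minus_right complex_cnj_minus)

text \<open>\<open>c = 1\<close> yields the real part, \<open>c = \<i>\<close> the imaginary part up
  to sign. This lifts identities between real inner products, such as the one from
  \<open>riesz_representation\<close>, to complex ones.\<close>

lemma cinner_eqI:
  assumes "\<And>c. inner (c *c x) y = inner (c *c x') y'"
  shows "cinner x y = cinner x' y'"
proof (rule complex_eqI)
  show "Re (cinner x y) = Re (cinner x' y')"
    using assms[of 1] scaleC_of_real[of 1 x] scaleC_of_real[of 1 x'] by (simp add: Re_cinner)
  show "Im (cinner x y) = Im (cinner x' y')"
    using assms[of \<i>] by (simp flip: Re_cinner add: cinner_scaleC_left)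
qed

text \<open>Orthogonality to \<open>z - z'\<close> is a closed condition, so it passes from
  \<open>S\<close> to every vector, in particular to \<open>z - z'\<close> itself.\<close>

lemma dense_cinner_eq_imp_eq:
  assumes dense: "closure S = UNIV" and eq: "\<And>x. x \<in> S \<Longrightarrow> cinner x z = cinner x z'"
  shows "z = z'"
proof -
  have "closed {x. inner x (z - z') = 0}"
    by (intro closed_Collect_eq continuous_intros)
  moreover have "S \<subseteq> {x. inner x (z - z') = 0}"
    using eq by (auto simp: inner_diff_right) (simp flip: Re_cinner)
  ultimately have "closure S \<subseteq> {x. inner x (z - z') = 0}" by (rule closure_minimal[rotated])
  then have "inner (z - z') (z - z') = 0" using dense by blast
  then show ?thesis by simp
qed

text \<open>Density makes the representing vector unique, so the definite description gives way to
  its defining relation.\<close>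

lemma op_adjoint_eq_Some_iff:
  assumes "densely_defined K"
  shows "op_adjoint K y = Some z \<longleftrightarrow> (\<forall>x\<in>dom K. cinner (the (K x)) y = cinner x z)"
proof -
  have uniq: "z = z'"
    if "\<forall>x\<in>dom K. cinner (the (K x)) y = cinner x z" "\<forall>x\<in>dom K. cinner (the (K x)) y = cinner x z'"
    for z z'
    using dense_cinner_eq_imp_eq[of "dom K"] assms that by (simp add: densely_defined_def)
  let ?P = "\<lambda>z. \<forall>x\<in>dom K. cinner (the (K x)) y = cinner x z"
  show ?thesis
  proof (cases "\<exists>z. ?P z")
    case True
    then obtain u where u: "?P u" by blast
    then have "(THE z. ?P z) = u" using uniq by (intro the_equality) blast+
    then have "op_adjoint K y = Some u" unfolding op_adjoint_def using True by simp
    then show ?thesis using u uniq by (metis option.inject)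
  next
    case False
    then have "op_adjoint K y = None" unfolding op_adjoint_def by simp
    then show ?thesis using False by (metis option.distinct(1))
  qed
qed

text \<open>The relation characterizing the adjoint survives sums and multiples of the pair
  \<open>(y, z)\<close>: a factor \<open>c\<close> enters both sides as
  \<open>cnj c\<close>.\<close>

lemma linear_op_adjoint:
  assumes "densely_defined K"
  shows "linear_op (op_adjoint K)"
proof -
  note iff = op_adjoint_eq_Some_iff[OF assms]
  have *: "y \<in> dom L \<and> the (L y) = z \<longleftrightarrow> L y = Some z" for L :: "'b \<rightharpoonup> 'a" and y z
    by auto
  have zero: "op_adjoint K 0 = Some 0"
    unfolding iff using cinner_scaleC_right[of _ 0 0] scaleC_of_real[of 0]
    by (metis complex_cnj_zero mult_zero_left of_real_0 scaleR_zero_left scaleC_scaleC)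
  have "op_adjoint K (x + y) = Some (u + v)" if "op_adjoint K x = Some u" "op_adjoint K y = Some v"
    for x y u v
    using that unfolding iff by (simp add: cinner_add_right)
  moreover have "op_adjoint K (c *c x) = Some (c *c u)" if "op_adjoint K x = Some u" for c x u
    using that unfolding iff by (simp add: cinner_scaleC_right)
  ultimately show ?thesis
    unfolding linear_op_def * using zero by (auto simp: *)
qed

lemma densely_defined_total_op: "densely_defined (total_op f)"
  by (simp add: densely_defined_def dom_def)

lemma badjoint_eqI:
  assumes "\<And>x. cinner (f x) y = cinner x z"
  shows "badjoint f y = z"
proof -
  have "op_adjoint (total_op f) y = Some z"
    unfolding op_adjoint_eq_Some_iff[OF densely_defined_total_op] using assms by simp
  then show ?thesis by (simp add: badjoint_def)
qed

text \<open>Riesz representation of the real functional \<open>inner (X x) y\<close> supplies a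
  vector, and complex homogeneity of \<open>X\<close> upgrades the identity to
  \<open>cinner\<close>. Hence the partial adjoint behind \<open>badjoint\<close> is defined
  everywhere.\<close>

lemma cinner_badjoint:
  fixes X :: "'a::complex_hilbert \<Rightarrow> 'b::complex_inner"
  assumes "bounded_clinear X"
  shows "cinner (X x) y = cinner x (badjoint X y)"
proof -
  have X: "bounded_linear X" and hom: "\<And>c x. X (c *c x) = c *c X x"
    using assms by (auto simp: bounded_clinear_def)
  have "bounded_linear (\<lambda>x. inner (X x) y)"
    by (rule bounded_linear_compose[OF bounded_linear_inner_left X])
  then obtain z where z: "\<And>x. inner (X x) y = inner x z"
    using riesz_representation by blast
  have "cinner (X x) y = cinner x z" for x
    by (rule cinner_eqI) (simp flip: hom z)
  with badjoint_eqI[of X y z] show ?thesis by simp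
qed

lemma inner_badjoint:
  fixes X :: "'a::complex_hilbert \<Rightarrow> 'b::complex_inner"
  assumes "bounded_clinear X"
  shows "inner (X x) y = inner x (badjoint X y)"
  using cinner_badjoint[OF assms] by (simp flip: Re_cinner)

lemma bounded_linear_badjoint:
  fixes X :: "'a::complex_hilbert \<Rightarrow> 'b::complex_inner"
  assumes X: "bounded_clinear X"
  shows "bounded_linear (badjoint X)"
proof -
  note adj = cinner_badjoint[OF X]
  interpret X: bounded_linear X using X by (simp add: bounded_clinear_def)
  obtain K where K: "\<And>x. norm (X x) \<le> norm x * K" and "0 \<le> K" using X.nonneg_bounded by auto
  show ?thesis
  proof (rule bounded_linear_intro)
    show "badjoint X (x + y) = badjoint X x + badjoint X y" for x y
      by (rule badjoint_eqI) (simp add: cinner_add_right adj)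
    show "badjoint X (r *\<^sub>R x) = r *\<^sub>R badjoint X x" for r x
      by (rule badjoint_eqI) (simp flip: scaleC_of_real add: cinner_scaleC_right adj)
    show "norm (badjoint X y) \<le> norm y * K" for y
    proof (cases "badjoint X y = 0")
      case False
      let ?z = "badjoint X y"
      \<comment> \<open>Testing the adjoint relation on \<open>?z\<close> itself leaves a common
        factor \<open>norm ?z\<close>, which cancels because \<open>?z\<close> is nonzero.\<close>
      have "norm ?z * norm ?z = inner (X ?z) y"
        by (simp add: inner_badjoint[OF X] power2_norm_eq_inner flip: power2_eq_square)
      also have "\<dots> \<le> norm (X ?z) * norm y" by (rule norm_cauchy_schwarz)
      also have "\<dots> \<le> (norm ?z * K) * norm y" by (intro mult_right_mono K) simp
      finally have "norm ?z * norm ?z \<le> norm ?z * (norm y * K)" by (simp add: mult_ac)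
      then show ?thesis using False by simp
    qed (use \<open>0 \<le> K\<close> in simp)
  qed
qed

section \<open>Skew block operators\<close>

lemma bounded_linear_skew_block:
  fixes X :: "'a::complex_hilbert \<Rightarrow> 'b::complex_inner"
  assumes X: "bounded_clinear X"
  shows "bounded_linear (skew_block X)"
proof -
  have "bounded_linear X" using X by (simp add: bounded_clinear_def)
  then have "bounded_linear (\<lambda>p. (- badjoint X (snd p), X (fst p)))"
    by (intro bounded_linear_Pair bounded_linear_minus
        bounded_linear_compose[OF bounded_linear_badjoint[OF X] bounded_linear_snd]
        bounded_linear_compose[OF _ bounded_linear_fst])
  then show ?thesis by (simp add: skew_block_def case_prod_beta')
qed

text \<open>The two cross terms cancel by symmetry of the real inner product. Its complex
  counterpart is only purely imaginary, which is why \<open>bij_id_plus_skew\<close> asks for real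
  orthogonality.\<close>

lemma inner_skew_block_self:
  fixes X :: "'a::complex_hilbert \<Rightarrow> 'b::complex_inner"
  assumes "bounded_clinear X"
  shows "inner p (skew_block X p) = 0"
  by (simp add: skew_block_def case_prod_beta' inner_prod_def flip: inner_badjoint[OF assms])
    (simp add: inner_commute)

lemma cinner_skew_block:
  fixes X :: "'a::complex_hilbert \<Rightarrow> 'b::complex_inner"
  assumes "bounded_clinear X"
  shows "cinner (skew_block X p) q = - cinner p (skew_block X q)"
proof -
  have "cinner (badjoint X g) f = cinner g (X f)" for f g
    using cinner_badjoint[OF assms, of f g] by (metis cinner_commute)
  then show ?thesis
    by (simp add: skew_block_def case_prod_beta' cinner_prod_def cinner_minus_left cinner_minus_right
        cinner_badjoint[OF assms])
qed

text \<open>By \<open>cinner_skew_block\<close>, moving the block to the other argument flips its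
  sign.\<close>

lemma badjoint_id_plus_skew_block:
  fixes X :: "'a::complex_hilbert \<Rightarrow> 'b::complex_inner"
  assumes "bounded_clinear X"
  shows "badjoint (\<lambda>x. x + skew_block X x) = (\<lambda>x. x - skew_block X x)"
proof
  fix y
  show "badjoint (\<lambda>x. x + skew_block X x) y = y - skew_block X y"
    by (rule badjoint_eqI, subst diff_conv_add_uminus)
      (simp add: cinner_add_left cinner_add_right cinner_minus_right cinner_skew_block[OF assms]
        del: add_uminus_conv_diff)
qed

section \<open>Linear operators\<close>

lemma linear_op_minus:
  assumes "linear_op K" and "x \<in> dom K"
  shows "- x \<in> dom K" and "the (K (- x)) = - the (K x)"
  using assms unfolding linear_op_def by (metis scaleC_minus_one)+

lemma linear_op_minus_iff:
  assumes "linear_op K"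
  shows "- x \<in> dom K \<longleftrightarrow> x \<in> dom K"
  using linear_op_minus(1)[OF assms] by (metis minus_minus)

lemma linear_op_add:
  assumes "linear_op K" and "x \<in> dom K" and "y \<in> dom K"
  shows "x + y \<in> dom K" and "the (K (x + y)) = the (K x) + the (K y)"
  using assms unfolding linear_op_def by blast+

lemma linear_op_diff:
  assumes "linear_op K" and "x \<in> dom K" and "y \<in> dom K"
  shows "x - y \<in> dom K" and "the (K (x - y)) = the (K x) - the (K y)"
  using linear_op_add[OF assms(1,2) linear_op_minus(1)[OF assms(1,3)]]
    linear_op_minus(2)[OF assms(1,3)] by simp_all

lemma linear_op_zero:
  assumes "linear_op K"
  shows "0 \<in> dom K" and "the (K 0) = 0"
  using assms linear_op_add(2)[OF assms, of 0 0] by (auto simp: linear_op_def)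

lemma map_le_iff_Some: "M \<subseteq>\<^sub>m N \<longleftrightarrow> (\<forall>x y. M x = Some y \<longrightarrow> N x = Some y)"
proof
  show "M \<subseteq>\<^sub>m N \<Longrightarrow> \<forall>x y. M x = Some y \<longrightarrow> N x = Some y"
    by (metis domI map_le_def)
  show "\<forall>x y. M x = Some y \<longrightarrow> N x = Some y \<Longrightarrow> M \<subseteq>\<^sub>m N"
    by (auto simp: map_le_def)
qed

text \<open>Trades the inverse for preimages, so that only the explicit block formulas of T and its
  adjoint enter.\<close>

lemma inv_image_subset_iff:
  assumes "bij f"
  shows "inv f ` S \<subseteq> S \<longleftrightarrow> (\<forall>x. f x \<in> S \<longrightarrow> x \<in> S)"
  using assms by (metis bij_inv_eq_iff image_subset_iff)

section \<open>Reducing graph subspaces\<close>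

theorem lemma2p7:
  fixes A0 :: "'a::complex_hilbert \<rightharpoonup> 'a"
    and A1 :: "'b::complex_hilbert \<rightharpoonup> 'b"
    and W :: "'b \<rightharpoonup> 'a"
    and X :: "'a \<Rightarrow> 'b"
    and A V :: "'a \<times> 'b \<rightharpoonup> 'a \<times> 'b"
    and Y T :: "'a \<times> 'b \<Rightarrow> 'a \<times> 'b"
    and G G' :: "('a \<times> 'b) set"
  assumes "linear_op A0" and "linear_op A1"
    and "A = block_diag A0 A1"
    and "self_adjoint_op A"
    and "linear_op W" and "densely_defined W"
    and "dom A1 \<subseteq> dom W" and "dom A0 \<subseteq> dom (op_adjoint W)"
    and "V = block_offdiag W (op_adjoint W)"
    and "bounded_clinear X"
    and "Y = skew_block X"
    and "T = (\<lambda>x. x + Y x)"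
    and "G = graph0 X"
    and "G' = graph1 (\<lambda>g. - badjoint X g)"
  shows "(reducing_for G G' (A +\<^sub>o V) \<longleftrightarrow>
            invariant_for G (A +\<^sub>o V) \<and> invariant_for G' (A +\<^sub>o V) \<and>
            inv T ` dom A \<subseteq> dom A)
       \<and> (reducing_for G G' (A +\<^sub>o V) \<longleftrightarrow>
            invariant_for G (A +\<^sub>o V) \<and> invariant_for G' (A +\<^sub>o V) \<and>
            inv (badjoint T) ` dom A \<subseteq> dom A)
       \<and> (reducing_for G G' (A +\<^sub>o V) \<longleftrightarrow>
            (A -\<^sub>o (total_op Y \<circ>\<^sub>m V)) \<circ>\<^sub>m total_op (badjoint T)
              \<subseteq>\<^sub>m total_op (badjoint T) \<circ>\<^sub>m (A +\<^sub>o V))"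
proof -
  note A0 = \<open>linear_op A0\<close> and A1 = \<open>linear_op A1\<close> and W = \<open>linear_op W\<close> and X = \<open>bounded_clinear X\<close>
  note Ws = linear_op_adjoint[OF \<open>densely_defined W\<close>]
  note defs = \<open>A = block_diag A0 A1\<close> \<open>V = block_offdiag W (op_adjoint W)\<close> \<open>Y = skew_block X\<close>
    \<open>T = (\<lambda>x. x + Y x)\<close> \<open>G = graph0 X\<close> \<open>G' = graph1 (\<lambda>g. - badjoint X g)\<close>

  \<comment> \<open>Domains and entries of the blocks\<close>
  define D0 D1 where "D0 = dom A0" and "D1 = dom A1"
  \<comment> \<open>Total versions of the partial entries. Outside the domains their values are the
    unspecified \<open>the None\<close>, so the linearity rules below are guarded by membership in
    \<open>D0\<close> or \<open>D1\<close>.\<close>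
  define a0 a1 w ws where "a0 = (\<lambda>f. the (A0 f))" and "a1 = (\<lambda>g. the (A1 g))"
    and "w = (\<lambda>g. the (W g))" and "ws = (\<lambda>f. the (op_adjoint W f))"
  define Z where "Z = badjoint X"
  interpret X: bounded_linear X using X by (simp add: bounded_clinear_def)
  interpret Z: bounded_linear Z unfolding Z_def by (rule bounded_linear_badjoint[OF X])

  have W_dom: "g \<in> dom W" if "g \<in> D1" for g
    using that \<open>dom A1 \<subseteq> dom W\<close> by (auto simp: D1_def)
  have Ws_dom: "f \<in> dom (op_adjoint W)" if "f \<in> D0" for f
    using that \<open>dom A0 \<subseteq> dom (op_adjoint W)\<close> by (auto simp: D0_def)
  have D0: "0 \<in> D0" "\<And>f f'. f \<in> D0 \<Longrightarrow> f' \<in> D0 \<Longrightarrow> f + f' \<in> D0"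
    "\<And>f f'. f \<in> D0 \<Longrightarrow> f' \<in> D0 \<Longrightarrow> f - f' \<in> D0" "\<And>f. - f \<in> D0 \<longleftrightarrow> f \<in> D0"
    using linear_op_zero(1)[OF A0] linear_op_add(1)[OF A0] linear_op_diff(1)[OF A0]
      linear_op_minus_iff[OF A0] by (auto simp: D0_def)
  have D1: "0 \<in> D1" "\<And>g g'. g \<in> D1 \<Longrightarrow> g' \<in> D1 \<Longrightarrow> g + g' \<in> D1"
    "\<And>g g'. g \<in> D1 \<Longrightarrow> g' \<in> D1 \<Longrightarrow> g - g' \<in> D1" "\<And>g. - g \<in> D1 \<longleftrightarrow> g \<in> D1"
    using linear_op_zero(1)[OF A1] linear_op_add(1)[OF A1] linear_op_diff(1)[OF A1]
      linear_op_minus_iff[OF A1] by (auto simp: D1_def)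
  \<comment> \<open>Sums are recorded on the first summand and differences on the second, matching
    the components \<open>f + Z g\<close> and \<open>g - X f\<close> of the adjoint of T.\<close>
  have lin0: "a0 0 = 0" "ws 0 = 0"
    "\<And>f. f \<in> D0 \<Longrightarrow> a0 (- f) = - a0 f" "\<And>f. f \<in> D0 \<Longrightarrow> ws (- f) = - ws f"
    "\<And>f f'. f \<in> D0 \<Longrightarrow> f' \<in> D0 \<Longrightarrow> a0 (f + f') = a0 f + a0 f'"
    "\<And>f f'. f \<in> D0 \<Longrightarrow> f' \<in> D0 \<Longrightarrow> ws (f + f') = ws f + ws f'"
    using linear_op_zero(2)[OF A0] linear_op_zero(2)[OF Ws] linear_op_minus(2)[OF A0]
      linear_op_minus(2)[OF Ws Ws_dom] linear_op_add(2)[OF A0] linear_op_add(2)[OF Ws Ws_dom Ws_dom]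
    by (auto simp: D0_def a0_def ws_def)
  have lin1: "a1 0 = 0" "w 0 = 0"
    "\<And>g. g \<in> D1 \<Longrightarrow> a1 (- g) = - a1 g" "\<And>g. g \<in> D1 \<Longrightarrow> w (- g) = - w g"
    "\<And>g g'. g \<in> D1 \<Longrightarrow> g' \<in> D1 \<Longrightarrow> a1 (g - g') = a1 g - a1 g'"
    "\<And>g g'. g \<in> D1 \<Longrightarrow> g' \<in> D1 \<Longrightarrow> w (g - g') = w g - w g'"
    using linear_op_zero(2)[OF A1] linear_op_zero(2)[OF W] linear_op_minus(2)[OF A1]
      linear_op_minus(2)[OF W W_dom] linear_op_diff(2)[OF A1] linear_op_diff(2)[OF W W_dom W_dom]
    by (auto simp: D1_def a1_def w_def)

  \<comment> \<open>Block formulas on the domain of A\<close>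
  have A_eq: "A (f, g) = (if f \<in> D0 \<and> g \<in> D1 then Some (a0 f, a1 g) else None)" for f g
    by (simp add: defs block_diag_def D0_def D1_def a0_def a1_def)
  have domA: "dom A = D0 \<times> D1" by (auto simp: A_eq split: if_splits)
  have V_eq: "V (f, g) = Some (w g, ws f)" if "f \<in> D0" "g \<in> D1" for f g
    using that W_dom Ws_dom by (auto simp: defs block_offdiag_def w_def ws_def)
  \<comment> \<open>The domain of V may be larger than that of A; this inclusion makes
    \<open>D0 \<times> D1\<close> the exact domain of both A + V and A - YV.\<close>
  then have domV: "D0 \<times> D1 \<subseteq> dom V" by auto
  have AV_eq: "(A +\<^sub>o V) (f, g) = (if f \<in> D0 \<and> g \<in> D1 then Some (a0 f + w g, a1 g + ws f) else None)"
    for f g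
    using domV by (auto simp: op_add_def domA A_eq V_eq)
  have domAV: "dom (A +\<^sub>o V) = D0 \<times> D1" by (auto simp: AV_eq split: if_splits)
  have Y_eq: "Y (f, g) = (- Z g, X f)" for f g by (simp add: defs skew_block_def Z_def)
  have AYV_eq: "(A -\<^sub>o (total_op Y \<circ>\<^sub>m V)) (f, g) =
      (if f \<in> D0 \<and> g \<in> D1 then Some (a0 f + Z (ws f), a1 g - X (w g)) else None)" for f g
    using domV by (auto simp: op_diff_def domA A_eq V_eq Y_eq map_comp_def dom_def)

  \<comment> \<open>Bijectivity of T and its adjoint\<close>
  have T_eq: "T (f, g) = (f - Z g, X f + g)" for f g
    by (simp add: defs(4) Y_eq algebra_simps)
  have Tadj: "badjoint T = (\<lambda>x. x - Y x)"
    using badjoint_id_plus_skew_block[OF X] by (simp add: defs(3,4))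
  have Tadj_eq: "badjoint T (f, g) = (f + Z g, g - X f)" for f g
    by (simp add: Tadj Y_eq)
  have Ybl: "bounded_linear Y" and Yskew: "\<And>x. inner x (Y x) = 0"
    using bounded_linear_skew_block[OF X] inner_skew_block_self[OF X] by (auto simp: defs(3))
  have "bij T" unfolding defs(4) by (rule bij_id_plus_skew[OF Ybl Yskew])
  \<comment> \<open>The adjoint of T is the identity plus -Y, and -Y is skew as well.\<close>
  have "bij (badjoint T)"
    using bij_id_plus_skew[OF bounded_linear_minus[OF Ybl]] Yskew by (simp add: Tadj)

  \<comment> \<open>Domain condition and Riccati equations\<close>
  define P where "P \<longleftrightarrow> (\<forall>f g. f - Z g \<in> D0 \<and> X f + g \<in> D1 \<longrightarrow> f \<in> D0 \<and> g \<in> D1)"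
  \<comment> \<open>\<open>R0\<close> and \<open>R1\<close> are the two components of the Riccati
    equation: \<open>R0\<close> says that A + V maps \<open>(f, X f)\<close> into the graph of X,
    \<open>R1\<close> that it maps \<open>(- Z g, g)\<close> into the complementary graph.\<close>
  define R0 where "R0 \<longleftrightarrow> (\<forall>f. f \<in> D0 \<and> X f \<in> D1 \<longrightarrow> a1 (X f) + ws f = X (a0 f + w (X f)))"
  define R1 where "R1 \<longleftrightarrow> (\<forall>g. g \<in> D1 \<and> Z g \<in> D0 \<longrightarrow> w g - a0 (Z g) = Z (ws (Z g) - a1 g))"
  have G: "(f, g) \<in> G \<longleftrightarrow> g = X f" and G': "(f, g) \<in> G' \<longleftrightarrow> f = - Z g" for f g
    by (auto simp: defs(5,6) graph0_def graph1_def Z_def)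
  have inv0: "invariant_for G (A +\<^sub>o V) \<longleftrightarrow> R0"
    by (simp add: invariant_for_def Ball_def split_paired_All domAV G AV_eq R0_def)
  have inv1: "invariant_for G' (A +\<^sub>o V) \<longleftrightarrow> R1"
  proof -
    have "invariant_for G' (A +\<^sub>o V) \<longleftrightarrow>
        (\<forall>g. g \<in> D1 \<and> Z g \<in> D0 \<longrightarrow> a0 (- Z g) + w g = - Z (a1 g + ws (- Z g)))"
      by (auto simp: invariant_for_def Ball_def split_paired_All domAV G' AV_eq D0)
    also have "\<dots> \<longleftrightarrow> R1"
      unfolding R1_def by (auto simp: lin0 Z.diff Z.add Z.neg algebra_simps)
    finally show ?thesis .
  qed
  have TP: "inv T ` dom A \<subseteq> dom A \<longleftrightarrow> P"
    unfolding inv_image_subset_iff[OF \<open>bij T\<close>] by (auto simp: domA T_eq P_def)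
  have P_neg: "P \<longleftrightarrow> (\<forall>f g. f + Z g \<in> D0 \<and> g - X f \<in> D1 \<longrightarrow> f \<in> D0 \<and> g \<in> D1)"
  proof -
    have "f - Z (- g) = f + Z g" "X f + - g \<in> D1 \<longleftrightarrow> g - X f \<in> D1" for f g
      using D1(4)[of "g - X f"] by (simp_all add: Z.neg)
    then have "(f + Z g \<in> D0 \<and> g - X f \<in> D1 \<longrightarrow> f \<in> D0 \<and> g \<in> D1) \<longleftrightarrow>
      (f - Z (- g) \<in> D0 \<and> X f + - g \<in> D1 \<longrightarrow> f \<in> D0 \<and> - g \<in> D1)" for f g
      by (simp only: D1(4))
    then show ?thesis unfolding P_def by (metis minus_minus)
  qed
  have TadjP: "inv (badjoint T) ` dom A \<subseteq> dom A \<longleftrightarrow> P"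
    unfolding inv_image_subset_iff[OF \<open>bij (badjoint T)\<close>] by (auto simp: domA Tadj_eq P_neg)

  \<comment> \<open>Splitting of the domain\<close>
  have split: "dom (A +\<^sub>o V) = {u + v | u v. u \<in> dom (A +\<^sub>o V) \<inter> G \<and> v \<in> dom (A +\<^sub>o V) \<inter> G'} \<longleftrightarrow> P"
    (is "_ = ?S \<longleftrightarrow> P")
  proof -
    \<comment> \<open>A vector of one graph plus a vector of the other is
      \<open>(f, X f) + (- Z g, g) = T (f, g)\<close>, so the sum set is an image under T and
      injectivity decides membership.\<close>
    have S: "?S = {T (f, g) | f g. f \<in> D0 \<and> X f \<in> D1 \<and> g \<in> D1 \<and> Z g \<in> D0}"
    proof -
      have "dom (A +\<^sub>o V) \<inter> G = {(f, X f) | f. f \<in> D0 \<and> X f \<in> D1}"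
        by (auto simp: domAV G)
      moreover have "dom (A +\<^sub>o V) \<inter> G' = {(- Z g, g) | g. g \<in> D1 \<and> Z g \<in> D0}"
        by (auto simp: domAV G' D0)
      moreover have "T (f, g) = (f, X f) + (- Z g, g)" for f g by (simp add: T_eq)
      ultimately show ?thesis by (simp only: mem_Collect_eq) blast
    qed
    have in_S: "T (f, g) \<in> ?S \<longleftrightarrow> f \<in> D0 \<and> X f \<in> D1 \<and> g \<in> D1 \<and> Z g \<in> D0" for f g
      unfolding S by (simp add: inj_eq[OF bij_is_inj[OF \<open>bij T\<close>]])
    \<comment> \<open>Since T is onto, the two sets need only be compared at points
      \<open>T x\<close>.\<close>
    have "dom (A +\<^sub>o V) = ?S \<longleftrightarrow> (\<forall>x. T x \<in> D0 \<times> D1 \<longleftrightarrow> T x \<in> ?S)"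
    proof -
      have "(\<forall>y. Q y) \<longleftrightarrow> (\<forall>x. Q (T x))" for Q
        using bij_is_surj[OF \<open>bij T\<close>] by (metis surjD)
      then show ?thesis unfolding domAV set_eq_iff .
    qed
    also have "\<dots> \<longleftrightarrow> (\<forall>f g. f - Z g \<in> D0 \<and> X f + g \<in> D1 \<longleftrightarrow>
        f \<in> D0 \<and> X f \<in> D1 \<and> g \<in> D1 \<and> Z g \<in> D0)"
      unfolding split_paired_All in_S by (simp add: T_eq)
    \<comment> \<open>The extra conditions come for free: \<open>X f\<close> is the difference of
      \<open>X f + g\<close> and \<open>g\<close>, and \<open>Z g\<close> that of \<open>f\<close>
      and \<open>f - Z g\<close>. The converse inclusion always holds, by linearity of the
      domains.\<close>
    also have "\<dots> \<longleftrightarrow> P"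
    proof -
      have "X f \<in> D1" if "X f + g \<in> D1" "g \<in> D1" for f g using D1(3)[OF that] by simp
      moreover have "Z g \<in> D0" if "f - Z g \<in> D0" "f \<in> D0" for f g using D0(3)[OF that(2,1)] by simp
      ultimately show ?thesis unfolding P_def using D0(3) D1(2) by blast
    qed
    finally show ?thesis .
  qed
  have red: "reducing_for G G' (A +\<^sub>o V) \<longleftrightarrow> R0 \<and> R1 \<and> P"
    unfolding reducing_for_def inv0 inv1 split ..

  \<comment> \<open>The extension relation\<close>
  let ?E = "\<lambda>f g. a0 (f + Z g) + Z (ws (f + Z g)) = a0 f + w g + Z (a1 g + ws f) \<and>
    a1 (g - X f) - X (w (g - X f)) = a1 g + ws f - X (a0 f + w g)"
  let ?L = "(A -\<^sub>o (total_op Y \<circ>\<^sub>m V)) \<circ>\<^sub>m total_op (badjoint T)"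
    and ?R = "total_op (badjoint T) \<circ>\<^sub>m (A +\<^sub>o V)"
  have L_eq: "?L (f, g) = (if f + Z g \<in> D0 \<and> g - X f \<in> D1
      then Some (a0 (f + Z g) + Z (ws (f + Z g)), a1 (g - X f) - X (w (g - X f))) else None)" for f g
    by (simp add: Tadj_eq AYV_eq)
  have R_eq: "?R (f, g) = (if f \<in> D0 \<and> g \<in> D1
      then Some (a0 f + w g + Z (a1 g + ws f), a1 g + ws f - X (a0 f + w g)) else None)" for f g
    by (simp add: map_comp_def AV_eq Tadj_eq)
  \<comment> \<open>Extension means inclusion of domains together with equal values. The first is
    \<open>P\<close> in the form \<open>P_neg\<close>; the second is \<open>?E\<close>, one equation
    per component.\<close>
  have "?L \<subseteq>\<^sub>m ?R \<longleftrightarrow>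
    (\<forall>f g. f + Z g \<in> D0 \<and> g - X f \<in> D1 \<longrightarrow> f \<in> D0 \<and> g \<in> D1 \<and> ?E f g)"
  proof -
    have "(\<forall>u. (if c then Some a else None) = Some u \<longrightarrow> (if d then Some b else None) = Some u) \<longleftrightarrow>
      (c \<longrightarrow> d \<and> a = b)" for c d and a b :: "'a \<times> 'b"
      by (auto simp del: split_paired_All)
    then have "(\<forall>u. ?L (f, g) = Some u \<longrightarrow> ?R (f, g) = Some u) \<longleftrightarrow>
      (f + Z g \<in> D0 \<and> g - X f \<in> D1 \<longrightarrow> (f \<in> D0 \<and> g \<in> D1) \<and> ?E f g)" for f g
      unfolding L_eq R_eq prod.inject[symmetric] .
    then show ?thesis
      unfolding map_le_iff_Some split_paired_All[of "\<lambda>x. \<forall>u. ?L x = Some u \<longrightarrow> ?R x = Some u"]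
      by (simp only: conj_assoc)
  qed
  also have "\<dots> \<longleftrightarrow> R0 \<and> R1 \<and> P"
  proof
    assume ext: "\<forall>f g. f + Z g \<in> D0 \<and> g - X f \<in> D1 \<longrightarrow> f \<in> D0 \<and> g \<in> D1 \<and> ?E f g"
    then have P unfolding P_neg by blast
    \<comment> \<open>At \<open>g = 0\<close> the second equation of \<open>?E\<close> is
      \<open>R0\<close> up to rearrangement.\<close>
    moreover have R0 unfolding R0_def
    proof (intro allI impI)
      fix f assume "f \<in> D0 \<and> X f \<in> D1"
      then show "a1 (X f) + ws f = X (a0 f + w (X f))"
        using ext[rule_format, of f 0] by (auto simp: D1 lin0 lin1 Z.zero X.add X.neg algebra_simps)
    qed
    \<comment> \<open>Symmetrically, \<open>f = 0\<close> in the first equation gives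
      \<open>R1\<close>.\<close>
    moreover have R1 unfolding R1_def
    proof (intro allI impI)
      fix g assume "g \<in> D1 \<and> Z g \<in> D0"
      then show "w g - a0 (Z g) = Z (ws (Z g) - a1 g)"
        using ext[rule_format, of 0 g] by (auto simp: D0 lin0 lin1 X.zero Z.diff algebra_simps)
    qed
    ultimately show "R0 \<and> R1 \<and> P" by blast
  next
    assume *: "R0 \<and> R1 \<and> P"
    show "\<forall>f g. f + Z g \<in> D0 \<and> g - X f \<in> D1 \<longrightarrow> f \<in> D0 \<and> g \<in> D1 \<and> ?E f g"
    proof (intro allI impI)
      fix f g assume fg: "f + Z g \<in> D0 \<and> g - X f \<in> D1"
      with * have f: "f \<in> D0" and g: "g \<in> D1" unfolding P_neg by blast+
      \<comment> \<open>Expanding \<open>?E\<close> by linearity requires the single summands to lie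
        in the domains. After expansion the first equation reduces to \<open>R1\<close> and the
        second to \<open>R0\<close>.\<close>
      have Zg: "Z g \<in> D0" using D0(3)[of "f + Z g" f] fg f by simp
      have Xf: "X f \<in> D1" using D1(3)[of g "g - X f"] fg g by simp
      have "a1 (X f) + ws f = X (a0 f + w (X f))" using * f Xf unfolding R0_def by blast
      moreover have "w g - a0 (Z g) = Z (ws (Z g) - a1 g)" using * g Zg unfolding R1_def by blast
      ultimately have "?E f g"
        using f g Zg Xf by (simp add: lin0 lin1 X.add X.diff Z.add Z.diff algebra_simps)
      with f g show "f \<in> D0 \<and> g \<in> D1 \<and> ?E f g" by blast
    qed
  qed
  finally show ?thesis unfolding red inv0 inv1 TP TadjP by blast
qed

end
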